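(* For every positive integer $n$, $\mathrm{sat}^*(n,\Lambda_3)\geq \frac{n}{2}$.
   Context: Let $[n]=\{1,\dots,n\}$ and let $\mathcal{P}([n])$ be the power set of $[n]$ ordered by inclusion. A family $\mathcal{F}\subseteq\mathcal{P}([n])$ is regarded as a poset under inclusion. A poset $(\mathcal{Q},\leq')$ contains an induced copy of a poset $(\mathcal{P},\leq)$ if there is an injective function $f:\mathcal{P}\to\mathcal{Q}$ such that for all $u,v\in\mathcal{P}$, $u\leq v$ if and only if $f(u)\leq' f(v)$; otherwise $\mathcal{Q}$ is $\mathcal{P}$-free. A family $\mathcal{F}\subseteq\mathcal{P}([n])$ is $\mathcal{P}$-saturated if $\mathcal{F}$ is $\mathcal{P}$-free but $\mathcal{F}\cup\{S\}$ contains an induced copy of $\mathcal{P}$ for every $S\in\mathcal{P}([n])\setminus\mathcal{F}$. The induced saturation number $\mathrm{sat}^*(n,\mathcal{P})$ is the minimum size of a $\mathcal{P}$-saturated family in $\mathcal{P}([n])$. $\Lambda_3$ is the four-element poset with one maximum element lying above three pairwise incomparable minimal elements. *)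

theory Defs
  imports Complex_Main
begin

text \<open>A poset is a subset of a type of class \<open>order\<close>, with the order restricted to that
  subset. In particular a family of sets carries the inclusion order.\<close>

definition contains_induced_copy :: "'q::order set \<Rightarrow> 'p::order set \<Rightarrow> bool" where
  "contains_induced_copy Q P \<longleftrightarrow>
     (\<exists>f. f ` P \<subseteq> Q \<and> inj_on f P \<and> (\<forall>u\<in>P. \<forall>v\<in>P. u \<le> v \<longleftrightarrow> f u \<le> f v))"

definition poset_free :: "'p::order set \<Rightarrow> 'q::order set \<Rightarrow> bool" where
  "poset_free P Q \<longleftrightarrow> \<not> contains_induced_copy Q P"

definition saturated :: "nat \<Rightarrow> 'p::order set \<Rightarrow> nat set set \<Rightarrow> bool" where
  "saturated n P F \<longleftrightarrow>
     F \<subseteq> Pow {1..n} \<and> poset_free P F \<and>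
     (\<forall>S \<in> Pow {1..n} - F. contains_induced_copy (F \<union> {S}) P)"

definition sat_star :: "nat \<Rightarrow> 'p::order set \<Rightarrow> nat" where
  "sat_star n P = (LEAST k. \<exists>F. saturated n P F \<and> card F = k)"

text \<open>The minimum is over a nonempty set whenever \<open>P\<close> is nonempty.\<close>

lemma saturated_exists:
  assumes "P \<noteq> {}"
  shows "\<exists>F. saturated n P F"
proof -
  let ?A = "{F. F \<subseteq> Pow {1..n} \<and> poset_free P F}"
  have "finite ?A"
    by (rule finite_subset[of _ "Pow (Pow {1..n})"]) auto
  moreover have "{} \<in> ?A"
    using assms by (auto simp: poset_free_def contains_induced_copy_def)
  ultimately obtain F where F: "F \<in> ?A" and max: "\<And>G. G \<in> ?A \<Longrightarrow> F \<subseteq> G \<Longrightarrow> F = G"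
    using finite_has_maximal[of ?A] by (metis (lifting) empty_iff)
  have "contains_induced_copy (F \<union> {S}) P" if "S \<in> Pow {1..n} - F" for S
  proof (rule ccontr)
    assume "\<not> contains_induced_copy (F \<union> {S}) P"
    then have "F \<union> {S} \<in> ?A"
      using F that by (simp add: poset_free_def)
    from max[OF this] have "F = F \<union> {S}"
      by blast
    with that show False
      by blast
  qed
  then show ?thesis
    using F by (auto simp: saturated_def)
qed

lemma sat_star_attained:
  assumes "P \<noteq> {}"
  shows "\<exists>F. saturated n P F \<and> card F = sat_star n P"
  unfolding sat_star_def by (rule LeastI_ex) (use saturated_exists[OF assms] in blast)

datatype lambda3 = Apex | Leg1 | Leg2 | Leg3

instantiation lambda3 :: order
begin

definition less_eq_lambda3 :: "lambda3 \<Rightarrow> lambda3 \<Rightarrow> bool" where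
  "x \<le> y \<longleftrightarrow> x = y \<or> y = Apex"

definition less_lambda3 :: "lambda3 \<Rightarrow> lambda3 \<Rightarrow> bool" where
  "x < y \<longleftrightarrow> x \<noteq> y \<and> y = Apex"

instance
  by standard (auto simp: less_eq_lambda3_def less_lambda3_def)

end

definition Lambda3 :: "lambda3 set" where
  "Lambda3 = UNIV"

end

theory Submission
  imports Defs
begin

text \<open>
  The bound holds in the stronger form \<open>n + 1 \<le> card F\<close> for every \<open>\<Lambda>\<^sub>3\<close>-saturated family \<open>F\<close>. The
  reason is that every \<open>i \<in> {1..n}\<close> is the label of an edge of the hypercube inside \<open>F\<close>: there is
  \<open>B \<in> F\<close> with \<open>i \<notin> B\<close> and \<open>insert i B \<in> F\<close> (lemma \<open>saturated_has_edge\<close>).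

  To find \<open>B\<close>, take it maximal among the members that avoid \<open>i\<close> and for which \<open>insert i B\<close>
  lies below some member \<open>E\<close>. If \<open>S = insert i B\<close> were not in \<open>F\<close>, then adding \<open>S\<close> would create a
  copy of \<open>\<Lambda>\<^sub>3\<close>. The set \<open>S\<close> cannot be its apex, because \<open>E\<close> would be an apex for the same three
  legs. So \<open>S\<close> is a leg, next to legs \<open>P\<close> and \<open>Q\<close> below an apex \<open>T\<close>. Replacing the leg \<open>S\<close> by \<open>B\<close>
  must destroy the copy, since \<open>F\<close> is free. As \<open>P\<close> and \<open>Q\<close> are incomparable and neither is contained
  in \<open>S\<close>, one of them, say \<open>P\<close>, properly contains \<open>B\<close>. But \<open>P\<close> does not contain \<open>S\<close>, so it avoids \<open>i\<close>, and
  \<open>insert i P\<close> lies below \<open>T\<close>: this contradicts the maximality of \<open>B\<close>.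

  One edge for each of \<open>n\<close> different labels forces \<open>n + 1\<close> vertices (lemma \<open>card_labels_less_card\<close>):
  contracting all edges of one label loses at least one vertex and keeps the other labels.
\<close>

definition antichain3 :: "'q::order \<Rightarrow> 'q \<Rightarrow> 'q \<Rightarrow> bool" where
  "antichain3 a b c \<longleftrightarrow>
     \<not> a \<le> b \<and> \<not> b \<le> a \<and> \<not> a \<le> c \<and> \<not> c \<le> a \<and> \<not> b \<le> c \<and> \<not> c \<le> b"

lemma contains_Lambda3_iff:
  fixes Q :: "'q::order set"
  shows "contains_induced_copy Q Lambda3 \<longleftrightarrow>
    (\<exists>t\<in>Q. \<exists>a\<in>Q. \<exists>b\<in>Q. \<exists>c\<in>Q. a < t \<and> b < t \<and> c < t \<and> antichain3 a b c)"
  (is "_ \<longleftrightarrow> ?claw")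
proof
  assume "contains_induced_copy Q Lambda3"
  then obtain f where f: "range f \<subseteq> Q" "inj f" "\<And>u v :: lambda3. u \<le> v \<longleftrightarrow> f u \<le> f v"
    unfolding contains_induced_copy_def Lambda3_def by auto
  have lt: "u < v \<longleftrightarrow> f u < f v" for u v
    using f(3) by (simp add: less_le_not_le)
  have "f Leg1 < f Apex" "f Leg2 < f Apex" "f Leg3 < f Apex"
    by (simp_all flip: lt add: less_lambda3_def)
  moreover have "antichain3 (f Leg1) (f Leg2) (f Leg3)"
    unfolding antichain3_def by (simp flip: f(3) add: less_eq_lambda3_def)
  ultimately show ?claw
    using f(1) by blast
next
  assume ?claw
  then obtain t a b c where Q: "t \<in> Q" "a \<in> Q" "b \<in> Q" "c \<in> Q"
    and lt: "a < t" "b < t" "c < t" and anti: "antichain3 a b c"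
    by blast
  define f where "f x = (case x of Apex \<Rightarrow> t | Leg1 \<Rightarrow> a | Leg2 \<Rightarrow> b | Leg3 \<Rightarrow> c)" for x
  have le: "u \<le> v \<longleftrightarrow> f u \<le> f v" for u v
    using lt anti unfolding f_def antichain3_def less_eq_lambda3_def
    by (cases u; cases v) (auto dest: less_imp_le leD)
  have "inj f"
    by (rule injI) (metis le order.antisym order.refl)
  moreover have "range f \<subseteq> Q"
    using Q by (auto simp: f_def split: lambda3.split)
  ultimately show "contains_induced_copy Q Lambda3"
    unfolding contains_induced_copy_def Lambda3_def using le by blast
qed

lemma Lambda3_freeD:
  assumes "poset_free Lambda3 F" "t \<in> F" "a \<in> F" "b \<in> F" "c \<in> F" "a < t" "b < t" "c < t"
  shows "\<not> antichain3 a b c"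
  using assms unfolding poset_free_def contains_Lambda3_iff by blast

text \<open>
  A copy of \<open>\<Lambda>\<^sub>3\<close> created by adding \<open>S\<close> must use \<open>S\<close>. The legs are interchangeable, so only
  the role of \<open>S\<close> as apex or as leg matters.
\<close>

lemma new_claw_cases:
  fixes F :: "'q::order set"
  assumes free: "poset_free Lambda3 F" and copy: "contains_induced_copy (F \<union> {S}) Lambda3"
  obtains (apex) a b c where "a \<in> F" "b \<in> F" "c \<in> F" "a < S" "b < S" "c < S" "antichain3 a b c"
    | (leg) t p q where "t \<in> F" "p \<in> F" "q \<in> F" "S < t" "p < t" "q < t" "antichain3 S p q"
proof -
  from copy obtain t a b c where
    mem: "t \<in> F \<union> {S}" "a \<in> F \<union> {S}" "b \<in> F \<union> {S}" "c \<in> F \<union> {S}"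
    and lt: "a < t" "b < t" "c < t" and anti: "antichain3 a b c"
    unfolding contains_Lambda3_iff by blast
  have swap: "antichain3 b a c" "antichain3 c a b"
    using anti by (auto simp: antichain3_def)
  have ne: "a \<noteq> b" "a \<noteq> c" "b \<noteq> c"
    using anti by (auto simp: antichain3_def)
  consider "t = S" | "a = S" | "b = S" | "c = S" | "t \<in> F" "a \<in> F" "b \<in> F" "c \<in> F"
    using mem by blast
  then show thesis
  proof cases
    case 1
    then show ?thesis using mem lt anti by (intro apex[of a b c]) auto
  next
    case 2
    then show ?thesis using mem lt anti ne by (intro leg[of t b c]) auto
  next
    case 3
    then show ?thesis using mem lt swap ne by (intro leg[of t a c]) auto
  next
    case 4
    then show ?thesis using mem lt swap ne by (intro leg[of t a b]) auto
  next
    case 5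
    then show ?thesis using Lambda3_freeD[OF free] lt anti by blast
  qed
qed

text \<open>
  The empty set is comparable to every set, hence not a leg, and it lies above nothing else.
\<close>

lemma empty_in_saturated:
  assumes sat: "saturated n Lambda3 F"
  shows "{} \<in> F"
proof (rule ccontr)
  assume "{} \<notin> F"
  then have "poset_free Lambda3 F" and "contains_induced_copy (F \<union> {{}}) Lambda3"
    using sat unfolding saturated_def by auto
  then show False
    by (cases rule: new_claw_cases) (auto simp: antichain3_def)
qed

text \<open>
  A singleton has only one proper subset, so it can enter a new copy of \<open>\<Lambda>\<^sub>3\<close> only as a
  leg, and then the apex is a member above it.
\<close>

lemma saturated_covers:
  assumes sat: "saturated n Lambda3 F" and i: "i \<in> {1..n}"
  shows "\<exists>E\<in>F. i \<in> E"
proof (cases "{i} \<in> F")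
  case False
  then have "poset_free Lambda3 F" and "contains_induced_copy (F \<union> {{i}}) Lambda3"
    using sat i unfolding saturated_def by auto
  then show ?thesis
  proof (cases rule: new_claw_cases)
    case (apex a b c)
    then have "a = {}" by auto
    then show ?thesis using apex by (simp add: antichain3_def)
  qed auto
qed auto

lemma saturated_has_edge:
  assumes sat: "saturated n Lambda3 F" and i: "i \<in> {1..n}"
  shows "\<exists>B\<in>F. i \<notin> B \<and> insert i B \<in> F"
proof -
  have sub: "F \<subseteq> Pow {1..n}" and free: "poset_free Lambda3 F"
    and copy: "\<And>S. S \<in> Pow {1..n} - F \<Longrightarrow> contains_induced_copy (F \<union> {S}) Lambda3"
    using sat unfolding saturated_def by auto
  define C where "C = {B \<in> F. i \<notin> B \<and> (\<exists>E\<in>F. insert i B \<subseteq> E)}"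
  have "finite C"
    using sub by (intro finite_subset[of C "Pow {1..n}"]) (auto simp: C_def)
  moreover have "{} \<in> C"
    using empty_in_saturated[OF sat] saturated_covers[OF sat i] by (auto simp: C_def)
  ultimately obtain B where B: "B \<in> C" and max: "\<And>P. P \<in> C \<Longrightarrow> B \<subseteq> P \<Longrightarrow> B = P"
    using finite_has_maximal[of C] by (metis empty_iff)
  then obtain E where E: "E \<in> F" "insert i B \<subseteq> E" and BF: "B \<in> F" "i \<notin> B"
    unfolding C_def by blast
  \<comment> \<open>A leg next to \<open>insert i B\<close> that contains \<open>B\<close> would be a larger candidate.\<close>
  have no_ext: False
    if "P \<in> F" "T \<in> F" "insert i B \<subseteq> T" "P \<subseteq> T" "B \<subseteq> P"
      "\<not> P \<subseteq> insert i B" "\<not> insert i B \<subseteq> P" for P T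
  proof -
    from that have "P \<in> C" unfolding C_def by auto
    with max \<open>B \<subseteq> P\<close> have "B = P" by blast
    with that(6) show False by blast
  qed
  have "insert i B \<in> F"
  proof (rule ccontr)
    assume notin: "insert i B \<notin> F"
    with E have "insert i B \<subset> E" by blast
    have "insert i B \<in> Pow {1..n} - F"
      using notin E sub by blast
    from free copy[OF this] show False
    proof (cases rule: new_claw_cases)
      case (apex a b c)
      then show ?thesis
        using Lambda3_freeD[OF free \<open>E \<in> F\<close>] \<open>insert i B \<subset> E\<close> by (meson order.strict_trans)
    next
      case (leg T P Q)
      have "B \<subset> T" using leg(4) by blast
      then have "\<not> antichain3 B P Q"
        using Lambda3_freeD[OF free] leg BF by blast
      with leg(7) have "B \<subseteq> P \<or> B \<subseteq> Q"
        unfolding antichain3_def by blast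
      then show ?thesis
        using no_ext[of P T] no_ext[of Q T] leg unfolding antichain3_def
        by (meson order.strict_implies_order)
    qed
  qed
  with BF show ?thesis by blast
qed

text \<open>
  Deleting the element \<open>i\<close> from all members is the contraction of the edges labelled \<open>i\<close>. It
  identifies the two ends of such an edge and preserves the edges with every other label.
\<close>

lemma card_labels_less_card:
  fixes F :: "'a set set"
  assumes "finite I" "finite F" "F \<noteq> {}"
    and "\<And>i. i \<in> I \<Longrightarrow> \<exists>B\<in>F. i \<notin> B \<and> insert i B \<in> F"
  shows "card I < card F"
  using assms
proof (induction I arbitrary: F rule: finite_induct)
  case empty
  then show ?case by (simp add: card_gt_0_iff)
next
  case (insert i I)
  let ?del = "\<lambda>A. A - {i}"
  obtain B where B: "B \<in> F" "i \<notin> B" "insert i B \<in> F"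
    using insert.prems(3) by blast
  have "\<exists>D\<in>?del ` F. j \<notin> D \<and> insert j D \<in> ?del ` F" if j: "j \<in> I" for j
  proof -
    obtain D where D: "D \<in> F" "j \<notin> D" "insert j D \<in> F"
      using insert.prems(3) j by blast
    have "insert j (?del D) = ?del (insert j D)"
      using j insert.hyps by auto
    with D show ?thesis by auto
  qed
  then have "card I < card (?del ` F)"
    using insert.prems by (intro insert.IH) auto
  moreover have "card (?del ` F) < card F"
  proof -
    have "?del B = ?del (insert i B)" "B \<noteq> insert i B"
      using B by auto
    then have "\<not> inj_on ?del F"
      using B unfolding inj_on_def by blast
    then show ?thesis
      using insert.prems(1) by (metis card_image_le eq_card_imp_inj_on le_neq_implies_less)
  qed
  ultimately show ?case
    using insert.hyps by simp
qed

theorem corollary2: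
  fixes n :: nat
  assumes "n \<ge> 1"
  shows "real (sat_star n Lambda3) \<ge> real n / 2"
proof -
  obtain F where sat: "saturated n Lambda3 F" and card: "card F = sat_star n Lambda3"
    using sat_star_attained[of Lambda3 n] by (auto simp: Lambda3_def)
  have "finite F"
    using sat finite_subset[of F "Pow {1..n}"] by (simp add: saturated_def)
  moreover have "F \<noteq> {}"
    using empty_in_saturated[OF sat] by blast
  ultimately have "card {1..n} < card F"
    using saturated_has_edge[OF sat] by (intro card_labels_less_card) auto
  then show ?thesis
    using card by simp
qed

end
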